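(* Let $A\subseteq\mathbb{R}$ be an $\mathcal{N}$-set and let $B\subseteq\mathbb{R}$ satisfy $|B|<\mathfrak{e}_{ubd}$. Then $A\cup B$ is also an $\mathcal{N}$-set.
   Context: A set $A\subseteq\mathbb{R}$ is called an $\mathcal{N}$-set if there is a sequence of non-negative reals $\langle a_n : n\in\omega\rangle$ such that (1) $\sum_{n=0}^\infty a_n=+\infty$, and (2) for every $a\in A$, $\sum_{n=0}^\infty a_n\,|\sin \pi n a|<\infty$. Notation: $\omega$ is the set of natural numbers, ${}^{\omega}\omega$ the set of functions $\omega\to\omega$, ${}^{n}\omega$ the set of sequences of natural numbers of length $n$, $[\omega]^{\omega}$ the set of infinite subsets of $\omega$; $\exists^\infty n$ means "there are infinitely many $n$". A family $\mathcal{H}\subseteq{}^{\omega}\omega$ is bounded if there is $b\in{}^{\omega}\omega$ such that for every $h\in\mathcal{H}$, $h(n)\leq b(n)$ for all but finitely many $n$. The cardinal $\mathfrak{e}_{ubd}$ is the minimum of $|\mathcal{H}|$ over all bounded $\mathcal{H}\subseteq{}^{\omega}\omega$ such that for every $X\in[\omega]^{\omega}$ and every sequence of functions $\pi_n:{}^{n}\omega\to\omega$ ($n\in\omega$), there is $h\in\mathcal{H}$ with $(\exists^\infty n\in X)\; h(n)\neq\pi_n(h\restriction n)$. *)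

theory Defs
  imports Complex_Main "HOL-Library.Infinite_Set"
begin

unbundle cardinal_syntax

definition N_set :: "real set \<Rightarrow> bool" where
  "N_set A \<longleftrightarrow>
     (\<exists>a :: nat \<Rightarrow> real.
        (\<forall>n. 0 \<le> a n) \<and>
        filterlim (\<lambda>N. \<Sum>n<N. a n) at_top sequentially \<and>
        (\<forall>x\<in>A. summable (\<lambda>n. a n * \<bar>sin (pi * real n * x)\<bar>)))"

definition bounded_family :: "(nat \<Rightarrow> nat) set \<Rightarrow> bool" where
  "bounded_family H \<longleftrightarrow> (\<exists>b :: nat \<Rightarrow> nat. \<forall>h\<in>H. \<forall>\<^sub>\<infinity>n. h n \<le> b n)"

text \<open>The restriction of \<open>h\<close> to \<open>{0, \<dots>, n - 1}\<close> is encoded as the list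
  \<open>map h [0..<n]\<close>; only the values of \<open>p n\<close> on lists of length \<open>n\<close> matter.\<close>

definition evades_prediction :: "(nat \<Rightarrow> nat) set \<Rightarrow> bool" where
  "evades_prediction H \<longleftrightarrow>
     (\<forall>(X :: nat set) (p :: nat \<Rightarrow> nat list \<Rightarrow> nat). infinite X \<longrightarrow>
        (\<exists>h\<in>H. \<exists>\<^sub>\<infinity>n. n \<in> X \<and> h n \<noteq> p n (map h [0..<n])))"

text \<open>Cardinals are represented by cardinal orders, so the minimum is determined up to
  \<open>=o\<close>. It exists: see \<open>e_ubd_least\<close> below.\<close>

definition e_ubd :: "(nat \<Rightarrow> nat) rel" where
  "e_ubd = (SOME r. (\<exists>H. bounded_family H \<and> evades_prediction H \<and> r = |H| ) \<and>
                    (\<forall>H. bounded_family H \<and> evades_prediction H \<longrightarrow> r \<le>o |H| ))"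

lemma bounded_evading_family_exists: "\<exists>H. bounded_family H \<and> evades_prediction H"
proof (intro exI conjI)
  let ?H = "{h :: nat \<Rightarrow> nat. \<forall>n. h n \<le> 1}"
  show "bounded_family ?H"
    unfolding bounded_family_def by (rule exI[of _ "\<lambda>_. 1"]) auto
  show "evades_prediction ?H"
    unfolding evades_prediction_def
  proof (intro allI impI)
    fix X :: "nat set" and p :: "nat \<Rightarrow> nat list \<Rightarrow> nat"
    assume X: "infinite X"
    define s where "s = rec_nat [] (\<lambda>n l. l @ [if p n l = 0 then 1 else 0 :: nat])"
    define h where "h n = (if p n (s n) = 0 then 1 else 0 :: nat)" for n
    have s: "map h [0..<n] = s n" for n
      by (induction n) (simp_all add: s_def h_def)
    have "h n \<noteq> p n (map h [0..<n])" for n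
      unfolding s by (simp add: h_def)
    then have "\<exists>\<^sub>\<infinity>n. n \<in> X \<and> h n \<noteq> p n (map h [0..<n])"
      using X by (simp add: INFM_iff_infinite)
    moreover have "h \<in> ?H"
      by (simp add: h_def)
    ultimately show "\<exists>h\<in>?H. \<exists>\<^sub>\<infinity>n. n \<in> X \<and> h n \<noteq> p n (map h [0..<n])"
      by blast
  qed
qed

lemma e_ubd_least:
  shows "\<exists>H. bounded_family H \<and> evades_prediction H \<and> e_ubd = |H|"
    and "bounded_family H \<Longrightarrow> evades_prediction H \<Longrightarrow> e_ubd \<le>o |H|"
proof -
  let ?P = "\<lambda>H. bounded_family H \<and> evades_prediction H"
  let ?Q = "\<lambda>r. (\<exists>H. bounded_family H \<and> evades_prediction H \<and> r = |H| ) \<and> (\<forall>H. ?P H \<longrightarrow> r \<le>o |H| )"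
  have "card_of ` Collect ?P \<noteq> {}"
    using bounded_evading_family_exists by (simp)
  moreover have "\<forall>r\<in>card_of ` Collect ?P. Well_order r"
    by (simp add: card_of_Well_order)
  ultimately have "\<exists>r\<in>card_of ` Collect ?P. \<forall>r'\<in>card_of ` Collect ?P. r \<le>o r'"
    by (rule exists_minim_Well_order)
  then obtain r where r: "r \<in> card_of ` Collect ?P"
    and least: "\<forall>r'\<in>card_of ` Collect ?P. r \<le>o r'"
    by (rule bexE)
  from r obtain H0 where "?P H0" "r = |H0|"
    by (elim imageE) simp
  moreover have "\<forall>H. ?P H \<longrightarrow> r \<le>o |H|"
    using least by simp
  ultimately have "?Q r"
    by (intro conjI exI[of _ H0]) simp_all
  then have "?Q e_ubd"
    unfolding e_ubd_def by (rule someI)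
  then show "\<exists>H. bounded_family H \<and> evades_prediction H \<and> e_ubd = |H|"
    and "bounded_family H \<Longrightarrow> evades_prediction H \<Longrightarrow> e_ubd \<le>o |H|"
    by simp_all
qed

end

(* Cut the indices of the weights a witnessing that A is an N-set into blocks, the n-th one so
   heavy that its weights sum to at least K n.  A set B of size less than e_ubd gives a bounded
   family of functions: the n-th value attached to x is the fractional part of x rounded to
   precision 1 / g n.  On infinitely many blocks n these values are predicted from the earlier
   ones, of which there are only finitely many patterns, their number being fixed before the n-th
   block is chosen.  Simultaneous Dirichlet approximation thus supplies, for each index i of the
   block, a multiplier k \<le> K n making k * i * x close to an integer for all correctly predicted
   x at once.  Normalising the weights of the block to total 1 and moving them
   from i to k * i yields the new weights: since \<bar>sin (k t)\<bar> \<le> k \<bar>sin t\<bar>, the normalisation by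
   at least K n pays for the multipliers on A. *)

theory Submission
  imports Defs "HOL-Analysis.Kronecker_Approximation_Theorem"
begin

section \<open>Regrouping series with non-negative terms\<close>

text \<open>Non-negativity lets the partial sums of each series be bounded by the total of the
  other. This serves both for moving weights to new indices and for summing block by block.\<close>

lemma summable_fiber_sums_iff:
  fixes g :: "nat \<Rightarrow> real" and \<phi> :: "nat \<Rightarrow> nat"
  assumes nonneg: "\<And>i. 0 \<le> g i" and fin: "\<And>m. finite (\<phi> -` {m})"
  shows "summable (\<lambda>m. \<Sum>i\<in>\<phi> -` {m}. g i) \<longleftrightarrow> summable g"
proof -
  have vimage: "(\<Sum>m<N. \<Sum>i\<in>\<phi> -` {m}. g i) = (\<Sum>i\<in>\<phi> -` {..<N}. g i)" for N
  proof -
    have "(\<Sum>i\<in>(\<Union>m<N. \<phi> -` {m}). g i) = (\<Sum>m<N. \<Sum>i\<in>\<phi> -` {m}. g i)"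
      using fin by (intro sum.UNION_disjoint) auto
    moreover have "(\<Union>m<N. \<phi> -` {m}) = \<phi> -` {..<N}"
      by auto
    ultimately show ?thesis
      by simp
  qed
  have fin': "finite (\<phi> -` {..<N})" for N
  proof -
    have "\<phi> -` {..<N} = (\<Union>m<N. \<phi> -` {m})"
      by auto
    then show ?thesis
      using fin by simp
  qed
  show ?thesis
  proof
    assume s: "summable (\<lambda>m. \<Sum>i\<in>\<phi> -` {m}. g i)"
    show "summable g"
    proof (rule bounded_imp_summable)
      fix N
      \<comment> \<open>The fibers over values below \<open>M\<close> cover all indices up to
        \<open>N\<close>.\<close>
      define M where "M = Suc (Max (\<phi> ` {..N}))"
      have "(\<Sum>i\<le>N. g i) \<le> (\<Sum>i\<in>\<phi> -` {..<M}. g i)"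
        by (rule sum_mono2) (auto simp: fin' nonneg M_def less_Suc_eq_le)
      also have "\<dots> \<le> (\<Sum>m. \<Sum>i\<in>\<phi> -` {m}. g i)"
        unfolding vimage[symmetric]
        by (rule sum_le_suminf[OF s]) (auto simp: nonneg intro: sum_nonneg)
      finally show "(\<Sum>i\<le>N. g i) \<le> (\<Sum>m. \<Sum>i\<in>\<phi> -` {m}. g i)" .
    qed (rule nonneg)
  next
    assume s: "summable g"
    show "summable (\<lambda>m. \<Sum>i\<in>\<phi> -` {m}. g i)"
    proof (rule bounded_imp_summable)
      fix N
      show "(\<Sum>m\<le>N. \<Sum>i\<in>\<phi> -` {m}. g i) \<le> suminf g"
        unfolding lessThan_Suc_atMost[symmetric] vimage
        by (rule sum_le_suminf[OF s fin']) (auto simp: nonneg)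
    qed (auto intro: sum_nonneg nonneg)
  qed
qed

lemma filterlim_sum_at_top_iff_not_summable:
  fixes a :: "nat \<Rightarrow> real"
  assumes nonneg: "\<And>i. 0 \<le> a i"
  shows "filterlim (\<lambda>N. \<Sum>n<N. a n) at_top sequentially \<longleftrightarrow> \<not> summable a"
proof
  assume "filterlim (\<lambda>N. \<Sum>n<N. a n) at_top sequentially"
  then show "\<not> summable a"
    using not_tendsto_and_filterlim_at_infinity[OF sequentially_bot]
      filterlim_at_top_imp_at_infinity
    by (metis summable_LIMSEQ)
next
  assume not_summable: "\<not> summable a"
  show "filterlim (\<lambda>N. \<Sum>n<N. a n) at_top sequentially"
    unfolding filterlim_at_top eventually_sequentially
  proof
    fix Z
    obtain N where N: "Z < (\<Sum>n\<le>N. a n)"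
      using bounded_imp_summable[of a Z] not_summable nonneg by (meson not_le)
    have "Z \<le> (\<Sum>n<M. a n)" if "M \<ge> Suc N" for M
    proof -
      have "(\<Sum>n\<le>N. a n) \<le> (\<Sum>n<M. a n)"
        using that by (intro sum_mono2) (auto simp: nonneg)
      then show ?thesis
        using N by linarith
    qed
    then show "\<exists>N. \<forall>n\<ge>N. Z \<le> (\<Sum>i<n. a i)"
      by blast
  qed
qed

text \<open>Moving weights along \<open>\<phi>\<close> may send several indices to the same
  \<open>m\<close>; the weight at \<open>m\<close> is then the sum over its fiber, and finite fibers
  keep it well defined.\<close>

lemma N_setI:
  fixes w :: "nat \<Rightarrow> real" and \<phi> :: "nat \<Rightarrow> nat"
  assumes nonneg: "\<And>i. 0 \<le> w i" and not_summable: "\<not> summable w"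
    and fin: "\<And>m. finite (\<phi> -` {m})"
    and summable: "\<And>x. x \<in> A \<Longrightarrow> summable (\<lambda>i. w i * \<bar>sin (pi * real (\<phi> i) * x)\<bar>)"
  shows "N_set A"
  unfolding N_set_def
proof (intro exI conjI allI ballI)
  let ?a = "\<lambda>m. \<Sum>i\<in>\<phi> -` {m}. w i"
  show nonneg': "0 \<le> ?a m" for m
    by (intro sum_nonneg nonneg)
  show "filterlim (\<lambda>N. \<Sum>m<N. ?a m) at_top sequentially"
    using not_summable
    by (simp add: filterlim_sum_at_top_iff_not_summable nonneg' summable_fiber_sums_iff nonneg fin)
  fix x assume "x \<in> A"
  then have "summable (\<lambda>m. \<Sum>i\<in>\<phi> -` {m}. w i * \<bar>sin (pi * real (\<phi> i) * x)\<bar>)"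
    using summable by (subst summable_fiber_sums_iff) (auto simp: nonneg fin)
  then show "summable (\<lambda>m. ?a m * \<bar>sin (pi * real m * x)\<bar>)"
    by (simp add: sum_distrib_right)
qed

section \<open>Sine estimates and simultaneous approximation\<close>

lemma abs_sin_of_nat_mult_le: "\<bar>sin (real k * t)\<bar> \<le> real k * \<bar>sin t\<bar>"
proof (induction k)
  case (Suc k)
  have "\<bar>sin (real (Suc k) * t)\<bar> = \<bar>sin (real k * t) * cos t + cos (real k * t) * sin t\<bar>"
    by (simp add: distrib_right sin_add algebra_simps)
  also have "\<dots> \<le> \<bar>sin (real k * t)\<bar> * \<bar>cos t\<bar> + \<bar>cos (real k * t)\<bar> * \<bar>sin t\<bar>"
    by (metis abs_mult abs_triangle_ineq)
  also have "\<dots> \<le> \<bar>sin (real k * t)\<bar> * 1 + 1 * \<bar>sin t\<bar>"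
    by (intro add_mono mult_mono) auto
  finally show ?case
    using Suc.IH by (simp add: distrib_right)
qed simp

lemma abs_sin_pi_mult_le: "\<bar>sin (pi * z)\<bar> \<le> pi * \<bar>z - of_int p\<bar>"
proof -
  have "\<bar>sin (pi * z)\<bar> = \<bar>sin (pi * (z - of_int p))\<bar>"
    by (simp add: right_diff_distrib sin_diff abs_mult)
  also have "\<dots> \<le> \<bar>pi * (z - of_int p)\<bar>"
    by (rule abs_sin_x_le_abs_x)
  finally show ?thesis
    by (simp add: abs_mult)
qed

text \<open>The bound \<open>Q ^ m\<close> depends only on an upper bound for the size of
  \<open>Y\<close>, so it can be fixed before \<open>Y\<close> is known.\<close>

lemma Dirichlet_approx_finite_set:
  fixes Y :: "real set"
  assumes "finite Y" "card Y \<le> m" "Q > 0"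
  obtains k where "1 \<le> k" "k \<le> Q ^ m"
    "\<And>y. y \<in> Y \<Longrightarrow> \<exists>p::int. \<bar>real k * y - of_int p\<bar> < 1 / real Q"
proof -
  obtain \<theta> where \<theta>: "\<theta> ` {0..<card Y} = Y"
    using ex_bij_betw_nat_finite[OF \<open>finite Y\<close>] by (auto simp: bij_betw_def)
  obtain q p where q: "0 < q" "q \<le> int (Q ^ card Y)"
    and p: "\<And>i. i < card Y \<Longrightarrow> \<bar>of_int q * \<theta> i - of_int (p i)\<bar> < 1 / real Q"
    using Dirichlet_approx_simult[OF \<open>Q > 0\<close>, of "card Y" \<theta>] by metis
  show thesis
  proof
    show "1 \<le> nat q"
      using q by linarith
    have "Q ^ card Y \<le> Q ^ m"
      using assms by (intro power_increasing) auto
    then show "nat q \<le> Q ^ m"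
      using q by linarith
    fix y assume "y \<in> Y"
    then obtain i where "i < card Y" "y = \<theta> i"
      using \<theta> by force
    moreover have "real (nat q) = of_int q"
      using q by simp
    ultimately show "\<exists>p::int. \<bar>real (nat q) * y - of_int p\<bar> < 1 / real Q"
      using p by metis
  qed
qed

section \<open>Prediction and counting of prefixes\<close>

text \<open>By minimality of \<open>e_ubd\<close> the family \<open>H\<close> is not evading, and
  the negation of evasion yields a single predictor that works for all of \<open>H\<close>.\<close>

lemma bounded_family_predictable:
  assumes "bounded_family H" and "|H| <o e_ubd"
  obtains X p where "infinite X" "\<And>h. h \<in> H \<Longrightarrow> \<forall>\<^sub>\<infinity>n. n \<in> X \<longrightarrow> h n = p n (map h [0..<n])"
proof -
  have "\<not> evades_prediction H"
    using e_ubd_least(2)[OF assms(1)] assms(2) not_ordLess_ordLeq by blast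
  then show thesis
    unfolding evades_prediction_def not_all not_imp using that by (auto simp: not_INFM)
qed

text \<open>This bounds the number of values a predictor can give at \<open>n\<close>, and hence the
  dimension in which Dirichlet's theorem is applied.\<close>

lemma card_bounded_prefixes_le:
  fixes g :: "nat \<Rightarrow> nat"
  defines "S \<equiv> \<lambda>n. (\<lambda>f. map f [0..<n]) ` (PiE {..<n} (\<lambda>j. {..<g j}))"
  shows "finite (S n)" "card (S n) \<le> (\<Prod>j<n. g j)"
    and "(\<And>j. j < n \<Longrightarrow> h j < g j) \<Longrightarrow> map h [0..<n] \<in> S n"
proof -
  show "finite (S n)"
    unfolding S_def by (intro finite_imageI finite_PiE) auto
  have "card (S n) \<le> card (PiE {..<n} (\<lambda>j. {..<g j}))"
    unfolding S_def by (intro card_image_le finite_PiE) auto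
  then show "card (S n) \<le> (\<Prod>j<n. g j)"
    by (simp add: card_PiE)
  assume h: "\<And>j. j < n \<Longrightarrow> h j < g j"
  show "map h [0..<n] \<in> S n"
    unfolding S_def
  proof (rule image_eqI)
    show "map h [0..<n] = map (restrict h {..<n}) [0..<n]"
      by simp
    show "restrict h {..<n} \<in> PiE {..<n} (\<lambda>j. {..<g j})"
      using h by auto
  qed
qed

section \<open>Division of the indices into blocks\<close>

text \<open>\<open>M n\<close> bounds the number of prefixes of length \<open>n\<close>. The multiplier bound \<open>(2 ^ n) ^ M n\<close>
  must be available before the end \<open>N (Suc n)\<close> of the \<open>n\<close>-th block is chosen, and the
  precision \<open>g n\<close> depends on both.\<close>

lemma heavy_blocks_exist:
  fixes a :: "nat \<Rightarrow> real"
  assumes "filterlim (\<lambda>N. \<Sum>n<N. a n) at_top sequentially"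
  obtains N M g :: "nat \<Rightarrow> nat" where "N 0 = 0" "strict_mono N"
    "\<And>n. M n = (\<Prod>j<n. g j)"
    "\<And>n. g n = (2 ^ n) ^ M n * 2 ^ n * N (Suc n)"
    "\<And>n. real ((2 ^ n) ^ M n) \<le> (\<Sum>i=N n..<N (Suc n). a i)"
proof -
  \<comment> \<open>A state pairs the start of the current block with the product of all earlier
    \<open>g j\<close>; the factor applied to \<open>M\<close> is the new
    \<open>g n\<close>.\<close>
  define R where "R n s s' \<longleftrightarrow>
      (case s of (N, M) \<Rightarrow> case s' of (N', M') \<Rightarrow> N < N' \<and>
        real ((2 ^ n) ^ M) \<le> (\<Sum>i=N..<N'. a i) \<and> M' = M * ((2 ^ n) ^ M * 2 ^ n * N'))"
    for n :: nat and s s' :: "nat \<times> nat"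
  have step: "\<exists>s'. R n s s'" for n s
  proof -
    obtain N M where s: "s = (N, M)"
      by force
    \<comment> \<open>Including the sum below \<open>N\<close> in the lower bound leaves the
      required weight for the block itself.\<close>
    have "\<forall>\<^sub>F N' in sequentially. real ((2 ^ n) ^ M) + (\<Sum>i<N. a i) \<le> (\<Sum>i<N'. a i)"
      using assms unfolding filterlim_at_top by blast
    with eventually_gt_at_top[of N]
    have "\<forall>\<^sub>F N' in sequentially. N < N' \<and> real ((2 ^ n) ^ M) + (\<Sum>i<N. a i) \<le> (\<Sum>i<N'. a i)"
      by eventually_elim simp
    then obtain N' where N': "N < N'" "real ((2 ^ n) ^ M) + (\<Sum>i<N. a i) \<le> (\<Sum>i<N'. a i)"
      unfolding eventually_sequentially by blast
    have "(\<Sum>i<N'. a i) = (\<Sum>i<N. a i) + (\<Sum>i=N..<N'. a i)"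
      using N'(1) sum.atLeastLessThan_concat[of 0 N N' a] by (simp add: lessThan_atLeast0)
    then have "R n s (N', M * ((2 ^ n) ^ M * 2 ^ n * N'))"
      using N' by (simp add: R_def s)
    then show ?thesis ..
  qed
  obtain f where f: "f 0 = (0, 1)" "\<And>n. R n (f n) (f (Suc n))"
    using dependent_nat_choice[of "\<lambda>n s. n = 0 \<longrightarrow> s = (0, 1)" R] step
    by (metis nat.distinct(1))
  define N M where "N n = fst (f n)" and "M n = snd (f n)" for n
  define g where "g n = (2 ^ n) ^ M n * 2 ^ n * N (Suc n)" for n
  have R: "N n < N (Suc n)" "real ((2 ^ n) ^ M n) \<le> (\<Sum>i=N n..<N (Suc n). a i)"
    "M (Suc n) = M n * g n" for n
    using f(2)[of n] by (auto simp: R_def N_def M_def g_def split: prod.splits)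
  show thesis
  proof
    show "N 0 = 0"
      by (simp add: N_def f)
    show "strict_mono N"
      using R by (simp add: strict_mono_Suc_iff)
    show "M n = (\<Prod>j<n. g j)" for n
      by (induction n) (use f(1) R(3) in \<open>simp_all add: M_def\<close>)
  qed (use R g_def in auto)
qed

lemma strict_mono_block_index:
  fixes N :: "nat \<Rightarrow> nat"
  assumes "N 0 = 0" "strict_mono N"
  obtains \<beta> where "\<And>n. \<beta> -` {n} = {N n..<N (Suc n)}"
proof
  \<comment> \<open>Minimality of the block gives \<open>N (\<beta> i) \<le> i\<close>; block 0
    relies on \<open>N 0 = 0\<close>.\<close>
  define \<beta> where "\<beta> i = (LEAST n. i < N (Suc n))" for i
  have lt: "i < N (Suc (\<beta> i))" for i
    unfolding \<beta>_def
  proof (rule LeastI)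
    show "i < N (Suc i)"
      using strict_mono_imp_increasing[OF assms(2), of "Suc i"] by linarith
  qed
  have ge: "N (\<beta> i) \<le> i" for i
  proof (cases "\<beta> i")
    case (Suc n)
    then have "\<not> i < N (Suc n)"
      using not_less_Least[of n "\<lambda>n. i < N (Suc n)"] by (simp add: \<beta>_def)
    then show ?thesis
      by (simp add: Suc)
  qed (simp add: assms)
  have "\<beta> i = n" if "N n \<le> i" "i < N (Suc n)" for i n
  proof -
    have "N n < N (Suc (\<beta> i))" "N (\<beta> i) < N (Suc n)"
      using that lt[of i] ge[of i] by linarith+
    then show ?thesis
      using assms(2) by (simp add: strict_mono_less)
  qed
  then show "\<beta> -` {n} = {N n..<N (Suc n)}" for n
    using lt ge by auto
qed

section \<open>Rounded fractional parts\<close>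

text \<open>Passing to the fractional part costs nothing, since integer shifts of \<open>x\<close>
  change \<open>sin (pi * real m * x)\<close> only in sign; it makes the values at \<open>n\<close>
  bounded by \<open>g n\<close>, uniformly in \<open>x\<close>.\<close>

definition digit :: "(nat \<Rightarrow> nat) \<Rightarrow> real \<Rightarrow> nat \<Rightarrow> nat" where
  "digit g x n = nat \<lfloor>frac x * real (g n)\<rfloor>"

lemma digit_less: "g n > 0 \<Longrightarrow> digit g x n < g n"
proof -
  assume "g n > 0"
  then have "frac x * real (g n) < real (g n)"
    using frac_lt_1[of x] by simp
  then show ?thesis
    using \<open>g n > 0\<close> unfolding digit_def by (simp add: nat_less_iff floor_less_iff)
qed

lemma digit_approx:
  assumes "g n > 0"
  shows "\<bar>frac x - real (digit g x n) / real (g n)\<bar> \<le> 1 / real (g n)"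
proof -
  have "0 \<le> frac x * real (g n)"
    by simp
  then have "real (digit g x n) = of_int \<lfloor>frac x * real (g n)\<rfloor>"
    by (simp add: digit_def)
  then have "\<bar>frac x * real (g n) - real (digit g x n)\<bar> \<le> 1"
    by linarith
  then have "\<bar>frac x * real (g n) - real (digit g x n)\<bar> / real (g n) \<le> 1 / real (g n)"
    by (intro divide_right_mono) auto
  moreover have "frac x - real (digit g x n) / real (g n)
      = (frac x * real (g n) - real (digit g x n)) / real (g n)"
    using assms by (simp add: field_simps)
  ultimately show ?thesis
    by simp
qed

text \<open>Two errors of at most \<open>1 / Q\<close> add up: rounding contributes
  \<open>k * i / g n\<close>, at most \<open>K * L / (K * Q * L)\<close>, and the rest is the
  Dirichlet error.\<close>

lemma abs_sin_predicted_le: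
  fixes k i K Q L :: nat
  assumes g: "g n = K * Q * L" "g n > 0" and "k \<le> K" "i \<le> L"
    and p: "\<bar>real k * (real i * (real (digit g x n) / real (g n))) - of_int p\<bar> < 1 / real Q"
  shows "\<bar>sin (pi * real (k * i) * x)\<bar> \<le> 2 * pi / real Q"
proof -
  define c where "c = real (digit g x n) / real (g n)"
  \<comment> \<open>The term with the floor restores the integer part of \<open>x\<close> dropped by
    \<open>digit\<close>.\<close>
  define r where "r = int (k * i) * \<lfloor>x\<rfloor> + p"
  have pos: "K > 0" "Q > 0" "L > 0"
    using g by auto
  have "real (k * i) * x - of_int r = real (k * i) * (frac x - c) + (real k * (real i * c) - of_int p)"
    by (simp add: r_def frac_def algebra_simps)
  also have "\<bar>\<dots>\<bar> \<le> real (k * i) * \<bar>frac x - c\<bar> + \<bar>real k * (real i * c) - of_int p\<bar>"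
    by (rule order_trans[OF abs_triangle_ineq]) (simp add: abs_mult)
  also have "real (k * i) * \<bar>frac x - c\<bar> \<le> real (K * L) * (1 / real (g n))"
    unfolding c_def using digit_approx[of g n x] assms
    by (intro mult_mono of_nat_mono mult_le_mono) auto
  also have "\<dots> = 1 / real Q"
    using pos by (simp add: g field_simps)
  also have "\<bar>real k * (real i * c) - of_int p\<bar> \<le> 1 / real Q"
    using p by (simp add: c_def)
  finally have "\<bar>real (k * i) * x - of_int r\<bar> \<le> 2 / real Q"
    by simp
  then have "pi * \<bar>real (k * i) * x - of_int r\<bar> \<le> pi * (2 / real Q)"
    by (intro mult_left_mono) auto
  then show ?thesis
    using abs_sin_pi_mult_le[of "real (k * i) * x" r]
    by (simp add: mult.assoc) (simp add: mult.commute)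
qed

section \<open>The new weights and their verification\<close>

theorem proposition3p2:
  fixes A B :: "real set"
  assumes "N_set A"
    and "|B| <o e_ubd"
  shows "N_set (A \<union> B)"
proof -
  obtain a where a: "\<And>n. 0 \<le> a n" "filterlim (\<lambda>N. \<Sum>n<N. a n) at_top sequentially"
    "\<And>x. x \<in> A \<Longrightarrow> summable (\<lambda>n. a n * \<bar>sin (pi * real n * x)\<bar>)"
    using assms(1) unfolding N_set_def by (elim exE conjE, intro that) auto
  obtain N M g where N: "N 0 = 0" "strict_mono N"
    and M: "\<And>n. M n = (\<Prod>j<n. g j)"
    and g: "\<And>n. g n = (2 ^ n) ^ M n * 2 ^ n * N (Suc n)"
    and heavy: "\<And>n. real ((2 ^ n) ^ M n) \<le> (\<Sum>i=N n..<N (Suc n). a i)"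
    by (rule heavy_blocks_exist[OF a(2)]) (rule that)
  define K :: "nat \<Rightarrow> nat" where "K n = (2 ^ n) ^ M n" for n
  define W where "W n = (\<Sum>i=N n..<N (Suc n). a i)" for n
  have K: "1 \<le> K n" "real (K n) \<le> W n" for n
    using heavy by (simp_all add: K_def W_def)
  have W: "0 < W n" for n
    using K[of n] by linarith
  have g_pos: "0 < g n" for n
    using strict_monoD[OF N(2), of n "Suc n"] by (simp add: g)
  obtain \<beta> where \<beta>: "\<And>n. \<beta> -` {n} = {N n..<N (Suc n)}"
    using strict_mono_block_index[OF N] by blast
  have digit: "digit g x n < g n" for x n
    using g_pos by (rule digit_less)
  have "bounded_family (digit g ` B)"
    unfolding bounded_family_def
    using digit by (auto intro!: exI[of _ g] simp: less_imp_le)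
  moreover have "|digit g ` B| <o e_ubd"
    using card_of_image assms(2) ordLeq_ordLess_trans by blast
  ultimately obtain X p where X: "infinite X"
    and "\<And>h. h \<in> digit g ` B \<Longrightarrow> \<forall>\<^sub>\<infinity>n. n \<in> X \<longrightarrow> h n = p n (map h [0..<n])"
    using bounded_family_predictable by blast
  then have p: "\<forall>\<^sub>\<infinity>n. n \<in> X \<longrightarrow> digit g x n = p n (map (digit g x) [0..<n])" if "x \<in> B" for x
    using that by blast
  define S where "S n = (\<lambda>f. map f [0..<n]) ` (PiE {..<n} (\<lambda>j. {..<g j}))" for n
  \<comment> \<open>All possible predictions at block \<open>\<beta> i\<close> are approximated at
    once, so the multiplier depends on \<open>i\<close> but not on \<open>x\<close>.\<close>
  have "\<exists>k. 1 \<le> k \<and> k \<le> K (\<beta> i) \<and> (\<forall>\<sigma>\<in>S (\<beta> i). \<exists>q::int.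
      \<bar>real k * (real i * (real (p (\<beta> i) \<sigma>) / real (g (\<beta> i)))) - of_int q\<bar> < 1 / real (2 ^ \<beta> i))" for i
  proof -
    let ?Y = "(\<lambda>\<sigma>. real i * (real (p (\<beta> i) \<sigma>) / real (g (\<beta> i)))) ` S (\<beta> i)"
    have fin: "finite (S (\<beta> i))"
      unfolding S_def by (rule card_bounded_prefixes_le)
    have "card ?Y \<le> card (S (\<beta> i))"
      by (rule card_image_le[OF fin])
    also have "\<dots> \<le> M (\<beta> i)"
      unfolding S_def M by (rule card_bounded_prefixes_le)
    finally have card: "card ?Y \<le> M (\<beta> i)" .
    show ?thesis
      using Dirichlet_approx_finite_set[OF finite_imageI[OF fin] card, of "2 ^ \<beta> i"]
      unfolding K_def by (metis (no_types, lifting) image_eqI pos2 zero_less_power)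
  qed
  then obtain k where k: "\<And>i. 1 \<le> k i" "\<And>i. k i \<le> K (\<beta> i)"
    and approx: "\<And>i \<sigma>. \<sigma> \<in> S (\<beta> i) \<Longrightarrow> \<exists>q::int.
      \<bar>real (k i) * (real i * (real (p (\<beta> i) \<sigma>) / real (g (\<beta> i)))) - of_int q\<bar> < 1 / real (2 ^ \<beta> i)"
    by metis
  \<comment> \<open>Only blocks with a prediction carry weight, each of total 1. As \<open>X\<close>
    is infinite, this forces divergence.\<close>
  define w where "w i = (if \<beta> i \<in> X then a i / W (\<beta> i) else 0)" for i
  have w_nonneg: "0 \<le> w i" for i
    using a(1) W[of "\<beta> i"] by (simp add: w_def)
  have w_block: "(\<Sum>i\<in>\<beta> -` {n}. w i) = (if n \<in> X then 1 else 0)" for n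
  proof -
    have "(\<Sum>i\<in>\<beta> -` {n}. w i) = (\<Sum>i\<in>\<beta> -` {n}. if n \<in> X then a i / W n else 0)"
      by (intro sum.cong) (auto simp: w_def)
    also have "\<dots> = (if n \<in> X then W n / W n else 0)"
      by (simp add: \<beta> W_def flip: sum_divide_distrib)
    finally show ?thesis
      using W[of n] by simp
  qed
  have fin_\<beta>: "finite (\<beta> -` {n})" for n
    by (simp add: \<beta>)
  show ?thesis
  proof (rule N_setI[where \<phi> = "\<lambda>i. k i * i"])
    show "0 \<le> w i" for i
      by (rule w_nonneg)
    show "\<not> summable w"
    proof
      assume "summable w"
      then have "summable (\<lambda>n. \<Sum>i\<in>\<beta> -` {n}. w i)"
        using summable_fiber_sums_iff[OF w_nonneg fin_\<beta>] by simp
      then have "(\<lambda>n. if n \<in> X then 1 else 0 :: real) \<longlonglongrightarrow> 0"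
        unfolding w_block by (rule summable_LIMSEQ_zero)
      then have "\<forall>\<^sub>F n in sequentially. (if n \<in> X then 1 else 0 :: real) < 1"
        by (rule order_tendstoD) simp
      then have "\<forall>\<^sub>F n in sequentially. n \<notin> X"
        by eventually_elim (simp split: if_splits)
      then show False
        using X by (simp add: MOST_iff_cofinite flip: cofinite_eq_sequentially)
    qed
    show "finite ((\<lambda>i. k i * i) -` {m})" for m
    proof (rule finite_subset)
      \<comment> \<open>Multipliers are at least 1, so no index moves down.\<close>
      show "(\<lambda>i. k i * i) -` {m} \<subseteq> {..m}"
        using k(1) by (auto simp: Suc_le_eq)
    qed simp
    fix x assume "x \<in> A \<union> B"
    then show "summable (\<lambda>i. w i * \<bar>sin (pi * real (k i * i) * x)\<bar>)"
    proof
      assume "x \<in> A"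
      show ?thesis
      proof (rule summable_comparison_test'[OF a(3)[OF \<open>x \<in> A\<close>]])
        fix i
        have "w i * \<bar>sin (pi * real (k i * i) * x)\<bar> \<le> w i * (real (k i) * \<bar>sin (pi * real i * x)\<bar>)"
          using abs_sin_of_nat_mult_le[of "k i" "pi * real i * x"]
          by (intro mult_left_mono w_nonneg) (simp add: algebra_simps)
        \<comment> \<open>The factor \<open>k i\<close> lost in the sine estimate is absorbed by the
          division by \<open>W (\<beta> i)\<close>, because
          \<open>k i \<le> K (\<beta> i) \<le> W (\<beta> i)\<close>.\<close>
        also have "w i * real (k i) \<le> a i"
        proof (cases "\<beta> i \<in> X")
          case True
          have "real (k i) \<le> W (\<beta> i)"
            using k(2)[of i] K(2)[of "\<beta> i"] by linarith
          then have "a i * real (k i) \<le> a i * W (\<beta> i)"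
            by (intro mult_left_mono a(1))
          then show ?thesis
            using True W[of "\<beta> i"] by (simp add: w_def field_simps)
        qed (simp add: w_def a(1))
        then have "w i * (real (k i) * \<bar>sin (pi * real i * x)\<bar>) \<le> a i * \<bar>sin (pi * real i * x)\<bar>"
          unfolding mult.assoc[symmetric] by (rule mult_right_mono) simp
        finally show "norm (w i * \<bar>sin (pi * real (k i * i) * x)\<bar>) \<le> a i * \<bar>sin (pi * real i * x)\<bar>"
          using w_nonneg[of i] by (simp add: abs_mult)
      qed
    next
      assume "x \<in> B"
      let ?f = "\<lambda>i. w i * \<bar>sin (pi * real (k i * i) * x)\<bar>"
      \<comment> \<open>Prediction of \<open>x\<close> may fail on finitely many blocks, so the
        geometric bound on block sums holds only eventually.\<close>
      have "\<forall>\<^sub>F n in sequentially. norm (\<Sum>i\<in>\<beta> -` {n}. ?f i) \<le> 2 * pi * (1 / 2) ^ n"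
        using p[OF \<open>x \<in> B\<close>] unfolding cofinite_eq_sequentially
      proof eventually_elim
        case (elim n)
        have "?f i \<le> w i * (2 * pi / 2 ^ n)" if "i \<in> \<beta> -` {n}" for i
        proof (cases "n \<in> X")
          case True
          have \<beta>i: "\<beta> i = n" and i: "i \<le> N (Suc n)"
            using that \<beta>[of n] by auto
          have prefix: "map (digit g x) [0..<n] \<in> S n"
            unfolding S_def using digit by (intro card_bounded_prefixes_le)
          \<comment> \<open>A correct prediction from the actual prefix of \<open>x\<close> turns
            the approximation of the predicted value into one of its digit.\<close>
          then obtain q :: int where q:
            "\<bar>real (k i) * (real i * (real (digit g x n) / real (g n))) - of_int q\<bar> < 1 / real (2 ^ n)"
            using approx[of "map (digit g x) [0..<n]" i] elim True by (auto simp: \<beta>i)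
          have "g n = K n * 2 ^ n * N (Suc n)" "k i \<le> K n"
            using k(2)[of i] by (simp_all add: \<beta>i g K_def)
          then have "\<bar>sin (pi * real (k i * i) * x)\<bar> \<le> 2 * pi / real (2 ^ n)"
            using g_pos i q by (intro abs_sin_predicted_le)
          then show ?thesis
            by (intro mult_left_mono w_nonneg) simp
        qed (use that in \<open>simp add: w_def\<close>)
        then have "(\<Sum>i\<in>\<beta> -` {n}. ?f i) \<le> (\<Sum>i\<in>\<beta> -` {n}. w i) * (2 * pi / 2 ^ n)"
          unfolding sum_distrib_right by (rule sum_mono)
        also have "\<dots> \<le> 2 * pi * (1 / 2) ^ n"
          by (simp add: w_block power_divide)
        finally show ?case
          by (simp add: sum_nonneg w_nonneg)
      qed
      then have "summable (\<lambda>n. \<Sum>i\<in>\<beta> -` {n}. ?f i)"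
        by (rule summable_comparison_test_ev) (intro summable_mult summable_geometric, simp)
      then show ?thesis
        by (subst (asm) summable_fiber_sums_iff) (auto simp: w_nonneg fin_\<beta>)
    qed
  qed
qed

end
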